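(* Let $r,d\ge1$ be integers, $N=r+d$, and let $H=\begin{bmatrix}A&B\\C&D\end{bmatrix}\in M_N(\pm1)$ be a Hadamard matrix with $A\in M_r(\pm1)$ invertible, $D\in M_d(\pm1)$, and $\|A\|<\sqrt N$, where $\|\cdot\|$ is the operator norm. Then the polar decomposition $D=UT$ is given by $$U=\frac{1}{\sqrt N}(D-E),\qquad T=\sqrt N\, I_d-S,$$ where $E=CX_AB$ and $S=B^tY_AB$.
   Context: $M_n(\pm1)$ denotes the set of $n\times n$ matrices with entries in $\{-1,1\}$; a Hadamard matrix is a matrix in $M_n(\pm1)$ whose rows are pairwise orthogonal. The polar decomposition of a real square matrix $D$ is $D=UT$ with $T=\sqrt{D^tD}$ positive semi-definite and $U$ orthogonal; if $D$ is invertible then $U$ is unique and is written $Pol(D)$. For invertible $A\in M_r(\pm1)$ and the parameter $N$, define $$X_A=\left(\sqrt N I_r+\sqrt{A^tA}\right)^{-1}Pol(A)^t,\qquad Y_A=\left(\sqrt N I_r+\sqrt{AA^t}\right)^{-1}.$$ *)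

theory Defs
  imports "HOL-Analysis.Analysis"
begin

definition pm1_matrices :: "(real^'n^'n) set" where
  "pm1_matrices = {M. \<forall>i j. M $ i $ j \<in> {-1, 1}}"

text \<open>Orthogonality is required for distinct row indices, not for distinct elements of the
  set of rows (which would identify equal rows).\<close>

definition hadamard :: "real^'n^'n \<Rightarrow> bool" where
  "hadamard H \<longleftrightarrow>
     H \<in> pm1_matrices \<and> (\<forall>i j. i \<noteq> j \<longrightarrow> orthogonal (row i H) (row j H))"

text \<open>In \<open>real^'m^'n\<close> the outer index \<open>'n\<close> is the row index. The index type \<open>'r + 'd\<close> of the
  block matrix has \<open>CARD('r) + CARD('d)\<close> elements.\<close>

definition block_matrix ::
  "real^'r^'r \<Rightarrow> real^'d^'r \<Rightarrow> real^'r^'d \<Rightarrow> real^'d^'d \<Rightarrow> real^('r + 'd)^('r + 'd)" where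
  "block_matrix A B C D =
     (\<chi> i j. case i of
        Inl i' \<Rightarrow> (case j of Inl j' \<Rightarrow> A $ i' $ j' | Inr j' \<Rightarrow> B $ i' $ j')
      | Inr i' \<Rightarrow> (case j of Inl j' \<Rightarrow> C $ i' $ j' | Inr j' \<Rightarrow> D $ i' $ j'))"

definition psd_matrix :: "real^'n^'n \<Rightarrow> bool" where
  "psd_matrix M \<longleftrightarrow> transpose M = M \<and> (\<forall>x. 0 \<le> x \<bullet> (M *v x))"

text \<open>Meaningful only for positive semi-definite arguments, where the root exists and is
  unique.\<close>

definition psd_sqrt :: "real^'n^'n \<Rightarrow> real^'n^'n" where
  "psd_sqrt M = (THE R. psd_matrix R \<and> R ** R = M)"

definition polar_decomposition :: "real^'n^'n \<Rightarrow> real^'n^'n \<Rightarrow> real^'n^'n \<Rightarrow> bool" where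
  "polar_decomposition D U T \<longleftrightarrow>
     D = U ** T \<and> orthogonal_matrix U \<and> T = psd_sqrt (transpose D ** D)"

text \<open>Meaningful only for invertible arguments, where the orthogonal factor is unique.\<close>

definition Pol :: "real^'n^'n \<Rightarrow> real^'n^'n" where
  "Pol D = (THE U. \<exists>T. polar_decomposition D U T)"

definition X_mat :: "nat \<Rightarrow> real^'r^'r \<Rightarrow> real^'r^'r" where
  "X_mat N A =
     matrix_inv (sqrt (real N) *\<^sub>R mat 1 + psd_sqrt (transpose A ** A)) ** transpose (Pol A)"

definition Y_mat :: "nat \<Rightarrow> real^'r^'r \<Rightarrow> real^'r^'r" where
  "Y_mat N A = matrix_inv (sqrt (real N) *\<^sub>R mat 1 + psd_sqrt (A ** transpose A))"

end

theory Submission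
  imports Defs
begin

text \<open>
Write \<open>n = \<surd>N\<close>. A Hadamard matrix satisfies \<open>H H\<^sup>t = H\<^sup>t H = n\<^sup>2 I\<close>, and read block by block this
gives the relations between \<open>A, B, C, D\<close> from which everything follows. Let \<open>A = V P\<close> be the polar
decomposition of \<open>A\<close> and \<open>Q = A V\<^sup>t = V P V\<^sup>t\<close>, so that \<open>A = Q V\<close>, \<open>P = \<surd>(A\<^sup>t A)\<close> and
\<open>Q = \<surd>(A A\<^sup>t)\<close>. Then \<open>Y = (n I + Q)\<^sup>-\<^sup>1\<close> and \<open>X = V\<^sup>t Y\<close>. The point is the factorisation
\<open>B B\<^sup>t = n\<^sup>2 I - Q\<^sup>2 = (n I - Q) (n I + Q)\<close>, in which \<open>Y\<close> cancels a factor: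
\<open>Y B B\<^sup>t Y = 2 n Y - I\<close>. It makes \<open>E S\<close> and \<open>E\<^sup>t E\<close> linear expressions in \<open>S\<close>, \<open>E\<close> and the
blocks, and \<open>D S\<close> and \<open>D\<^sup>t E\<close> become linear by the off-diagonal block relations. Expanding
products then shows that \<open>(D - E) / n\<close> is orthogonal and that \<open>(D - E) (n I - S) = n D\<close>.
Finally \<open>n I - S\<close> is positive semi-definite because
\<open>n x\<^sup>t (n I - S) x = |D x|\<^sup>2 + (B x)\<^sup>t Q Y (B x)\<close>, where \<open>Q Y\<close> is positive semi-definite.
This is \<open>complementary_block_polar\<close>.

That these factors are the only ones follows from uniqueness of positive semi-definite roots
(\<open>psd_root_unique\<close>) and invertibility of \<open>D\<close>, which is inherited from \<open>A\<close>
(\<open>complementary_block_invertible\<close>).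

The existence of the polar decomposition of \<open>A\<close> is a variational fact: an orthogonal
\<open>V\<close> maximising \<open>trace (V\<^sup>t A)\<close> exists by compactness, and comparing it with \<open>V\<close> times one or two
reflections shows that \<open>V\<^sup>t A\<close> is symmetric and positive semi-definite (\<open>trace_maximal_imp_psd\<close>).
\<close>

section \<open>Matrix algebra\<close>

text \<open>Transposes are kept as matrices acting from the left, so that products can be regrouped by
associativity instead of turning into row-vector products.\<close>

declare transpose_matrix_vector [simp del]

lemma matrix_sub_ldistrib: "A ** (B - C) = A ** B - A ** (C :: real^'m^'k)"
  by (vector matrix_matrix_mult_def) (simp add: right_diff_distrib sum_subtractf)

lemma matrix_sub_rdistrib: "(A - B) ** C = A ** C - B ** (C :: real^'m^'k)"
  by (vector matrix_matrix_mult_def) (simp add: left_diff_distrib sum_subtractf)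

lemma matrix_add_rdistrib: "(A + B) ** C = A ** C + B ** (C :: real^'m^'k)"
  by (vector matrix_matrix_mult_def) (simp add: distrib_right sum.distrib)

lemma matrix_scaleR_left: "(k *\<^sub>R A) ** B = k *\<^sub>R (A ** (B :: real^'m^'k))"
  by (metis scalar_matrix_assoc)

lemma matrix_minus_left: "(- A) ** B = - (A ** (B :: real^'m^'k))"
  using matrix_scaleR_left[of "-1" A B] by simp

lemma matrix_scaleR_right: "A ** (k *\<^sub>R B) = k *\<^sub>R (A ** (B :: real^'m^'k))"
  by (metis matrix_scalar_ac scalar_matrix_assoc)

lemma transpose_add: "transpose (A + B) = transpose A + transpose (B :: real^'m^'k)"
  by (vector transpose_def)

lemma transpose_diff: "transpose (A - B) = transpose A - transpose (B :: real^'m^'k)"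
  by (vector transpose_def)

lemmas matrix_simps = matrix_sub_ldistrib matrix_sub_rdistrib matrix_add_ldistrib
  matrix_add_rdistrib matrix_scaleR_left matrix_scaleR_right transpose_add transpose_diff
  transpose_scalar matrix_transpose_mul

lemma inner_matrix_vector:
  fixes M :: "real^'n^'m"
  shows "x \<bullet> (M *v y) = (transpose M *v x) \<bullet> y"
  by (simp add: dot_lmul_matrix transpose_matrix_vector)

section \<open>Positive semi-definite matrices\<close>

lemma axis_form: "axis i 1 \<bullet> (M *v axis j 1) = (M :: real^'n^'m) $ i $ j"
  by (simp add: matrix_vector_mult_basis inner_axis' column_def)

lemma congruence_form:
  fixes R :: "real^'n^'n" and M :: "real^'m^'n"
  shows "x \<bullet> ((transpose M ** R ** M) *v x) = (M *v x) \<bullet> (R *v (M *v x))"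
  unfolding matrix_vector_mul_assoc[symmetric] inner_matrix_vector[of x] transpose_transpose ..

lemma psd_congruence: "psd_matrix R \<Longrightarrow> psd_matrix (transpose M ** R ** M)"
  by (simp add: psd_matrix_def matrix_transpose_mul matrix_mul_assoc congruence_form)

lemma psd_diag_nonneg: "psd_matrix R \<Longrightarrow> 0 \<le> R $ i $ i"
  by (metis axis_form psd_matrix_def)

text \<open>First-order optimality: a linear term that is dominated by a quadratic one vanishes.\<close>

lemma linear_le_quadratic_imp_zero:
  fixes a c :: real
  assumes "\<And>t. t * a \<le> t\<^sup>2 * c"
  shows "a = 0"
proof (rule ccontr)
  assume "a \<noteq> 0"
  define b where "b = \<bar>c\<bar> + 1"
  have "a * a / b \<le> a * a / b * (c / b)"
    using assms[of "a / b"] by (simp add: power2_eq_square)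
  moreover have "a * a / b > 0" "c / b < 1"
    using \<open>a \<noteq> 0\<close> by (auto simp: b_def field_simps zero_less_mult_iff intro!: divide_pos_pos)
  ultimately show False
    by (metis mult_less_cancel_left_pos mult.right_neutral not_le)
qed

text \<open>An isotropic vector minimises the quadratic form, so the form is stationary there; moving from
\<open>x\<close> in the direction of \<open>R x\<close> makes this explicit.\<close>

lemma psd_kernel:
  fixes R :: "real^'n^'n"
  assumes psd: "psd_matrix R" and 0: "x \<bullet> (R *v x) = 0"
  shows "R *v x = 0"
proof -
  define y where "y = R *v x"
  have xy: "x \<bullet> (R *v y) = y \<bullet> y"
    using inner_matrix_vector[of x R y] psd by (simp add: y_def psd_matrix_def)
  have "t * (2 * (y \<bullet> y)) \<le> t\<^sup>2 * (y \<bullet> (R *v y))" for t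
  proof -
    have "0 \<le> (x - t *\<^sub>R y) \<bullet> (R *v (x - t *\<^sub>R y))"
      using psd by (simp add: psd_matrix_def)
    also have "\<dots> = t\<^sup>2 * (y \<bullet> (R *v y)) - t * (2 * (y \<bullet> y))"
      using 0 xy by (simp add: matrix_vector_mult_diff_distrib matrix_vector_mult_scaleR
          inner_diff_left inner_diff_right y_def[symmetric] power2_eq_square right_diff_distrib)
    finally show ?thesis by simp
  qed
  from linear_le_quadratic_imp_zero[OF this] show ?thesis by (simp add: y_def)
qed

section \<open>Existence of polar decompositions by maximising a trace\<close>

lemma orthogonal_matrices_compact: "compact {W :: real^'n^'n. orthogonal_matrix W}"
proof -
  have "norm W \<le> CARD('n)" if "orthogonal_matrix W" for W :: "real^'n^'n"
  proof -
    have "norm (W $ i) = 1" for i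
      using that by (simp add: orthogonal_matrix_orthonormal_rows row_def)
    then show ?thesis
      using L2_set_le_sum[of UNIV "\<lambda>i. norm (W $ i)"] by (simp add: norm_vec_def)
  qed
  then have "bounded {W :: real^'n^'n. orthogonal_matrix W}"
    unfolding bounded_iff by blast
  moreover have "closed {W :: real^'n^'n. orthogonal_matrix W}"
    unfolding orthogonal_matrix transpose_def matrix_matrix_mult_def
    by (intro closed_Collect_eq continuous_intros)
  ultimately show ?thesis by (simp add: compact_eq_bounded_closed)
qed

definition outer :: "real^'n \<Rightarrow> real^'m \<Rightarrow> real^'m^'n" where
  "outer u v = (\<chi> i j. u $ i * v $ j)"

lemma outer_mult: "outer u v ** M = outer u (transpose M *v v)"
  by (vector outer_def matrix_matrix_mult_def matrix_vector_mult_def transpose_def)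
    (simp add: sum_distrib_left mult_ac)

lemma outer_mult_outer: "outer u v ** outer w z = (v \<bullet> w) *\<^sub>R outer u z"
  by (simp add: vec_eq_iff outer_def matrix_matrix_mult_def inner_vec_def sum_distrib_left sum_distrib_right
      mult_ac)

lemma transpose_outer: "transpose (outer u v) = outer v u"
  by (simp add: vec_eq_iff outer_def transpose_def)

lemma trace_outer: "trace (outer u v) = u \<bullet> v"
  by (simp add: trace_def outer_def inner_vec_def)

lemma trace_scaleR: "trace (k *\<^sub>R M) = k * trace (M :: real^'n^'n)"
  by (simp add: trace_def sum_distrib_left)

text \<open>For \<open>v = 0\<close> the coefficient \<open>2 / 0\<close> is \<open>0\<close>, so the matrix is the identity and hence still
orthogonal.\<close>

definition reflection :: "real^'n \<Rightarrow> real^'n^'n" where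
  "reflection v = mat 1 - (2 / (v \<bullet> v)) *\<^sub>R outer v v"

lemma trace_outer_mult: "trace (outer u v ** M) = v \<bullet> (M *v u)"
proof -
  have "trace (outer u v ** M) = (transpose M *v v) \<bullet> u"
    by (simp add: outer_mult trace_outer inner_commute)
  also have "\<dots> = v \<bullet> (M *v u)"
    by (rule inner_matrix_vector[symmetric])
  finally show ?thesis .
qed

lemma orthogonal_reflection: "orthogonal_matrix (reflection v)"
proof -
  define c where "c = 2 / (v \<bullet> v)"
  have "c * (c * (v \<bullet> v)) = c + c"
    by (cases "v = 0") (auto simp: c_def)
  then have "c *\<^sub>R c *\<^sub>R (v \<bullet> v) *\<^sub>R outer v v = c *\<^sub>R outer v v + c *\<^sub>R outer v v"
    by (metis scaleR_scaleR scaleR_left_distrib)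
  then show ?thesis
    unfolding orthogonal_matrix reflection_def c_def[symmetric]
    by (simp only: matrix_simps transpose_outer outer_mult_outer transpose_mat matrix_mul_lid
        matrix_mul_rid scaleR_diff_right) (simp add: algebra_simps)
qed

lemma trace_reflection:
  "trace (reflection v ** M) = trace M - 2 / (v \<bullet> v) * (v \<bullet> (M *v v))"
  by (simp add: reflection_def matrix_simps trace_sub trace_scaleR trace_outer_mult)

lemma trace_two_reflections:
  "trace (reflection u ** reflection v ** M) =
     trace M - 2 / (u \<bullet> u) * (u \<bullet> (M *v u)) - 2 / (v \<bullet> v) * (v \<bullet> (M *v v))
       + 4 * (u \<bullet> v) / ((u \<bullet> u) * (v \<bullet> v)) * (v \<bullet> (M *v u))"
proof -
  define a b where "a = 2 / (u \<bullet> u)" and "b = 2 / (v \<bullet> v)"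
  have "reflection u ** reflection v ** M =
      M - a *\<^sub>R (outer u u ** M) - b *\<^sub>R (outer v v ** M) + (a * b * (u \<bullet> v)) *\<^sub>R (outer u v ** M)"
    unfolding reflection_def a_def[symmetric] b_def[symmetric]
    by (simp add: matrix_simps outer_mult_outer scaleR_diff_right)
  then show ?thesis
    by (simp add: trace_add trace_sub trace_scaleR trace_outer_mult) (simp add: a_def b_def)
qed

text \<open>A single reflection along \<open>v\<close> changes the trace by \<open>-2 v\<^sup>t P v / |v|\<^sup>2\<close>, so maximality forces
the form to be nonnegative. Two reflections along \<open>e\<^sub>i\<close> and \<open>e\<^sub>i + t e\<^sub>j\<close> compose to a rotation of
the \<open>i,j\<close>-plane by an angle of order \<open>t\<close>; to first order in \<open>t\<close> it changes the trace by a multiple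
of \<open>P\<^sub>j\<^sub>i - P\<^sub>i\<^sub>j\<close>, which therefore vanishes.\<close>

lemma trace_maximal_imp_psd:
  fixes P :: "real^'n^'n"
  assumes max: "\<And>W. orthogonal_matrix W \<Longrightarrow> trace (W ** P) \<le> trace P"
  shows "psd_matrix P"
proof -
  have nonneg: "0 \<le> v \<bullet> (P *v v)" for v
  proof (cases "v = 0")
    case False
    then have "v \<bullet> v > 0" by simp
    then show ?thesis
      using max[OF orthogonal_reflection[of v]]
      by (simp add: trace_reflection zero_le_divide_iff zero_le_mult_iff del: inner_gt_zero_iff)
  qed simp
  have "P $ j $ i = P $ i $ j" if "i \<noteq> j" for i j
  proof -
    define e :: "'n \<Rightarrow> real^'n" where "e = (\<lambda>i. axis i 1)"
    have form: "e k \<bullet> (P *v e l) = P $ k $ l" for k l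
      by (simp add: e_def axis_form)
    have ip: "e k \<bullet> e l = (if k = l then 1 else 0)" for k l
      by (simp add: e_def inner_axis_axis)
    have "t * (P $ j $ i - P $ i $ j) \<le> t\<^sup>2 * (P $ i $ i + P $ j $ j)" for t
    proof -
      define v where "v = e i + t *\<^sub>R e j"
      have vv: "v \<bullet> v = 1 + t\<^sup>2"
        using that by (simp add: v_def inner_add_left inner_add_right ip power2_eq_square)
      have uv: "e i \<bullet> v = 1"
        using that by (simp add: v_def inner_add_right ip)
      have vPu: "v \<bullet> (P *v e i) = P $ i $ i + t * P $ j $ i"
        by (simp add: v_def inner_add_left form)
      have vPv: "v \<bullet> (P *v v) = P $ i $ i + t * (P $ i $ j + P $ j $ i) + t\<^sup>2 * P $ j $ j"
        by (simp add: v_def inner_add_left inner_add_right form matrix_vector_right_distrib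
            matrix_vector_mult_scaleR power2_eq_square algebra_simps)
      have pos: "0 < 1 + t\<^sup>2" by (simp add: add_pos_nonneg)
      have "orthogonal_matrix (reflection (e i) ** reflection v)"
        by (intro orthogonal_matrix_mul orthogonal_reflection)
      from max[OF this]
      have "- 2 * P $ i $ i - 2 / (1 + t\<^sup>2) * (v \<bullet> (P *v v))
            + 4 / (1 + t\<^sup>2) * (v \<bullet> (P *v e i)) \<le> 0"
        by (simp add: trace_two_reflections vv uv form ip)
      then have "(1 + t\<^sup>2) * (- 2 * P $ i $ i - 2 / (1 + t\<^sup>2) * (v \<bullet> (P *v v))
            + 4 / (1 + t\<^sup>2) * (v \<bullet> (P *v e i))) \<le> 0"
        using pos by (simp add: mult_le_0_iff)
      also have "(1 + t\<^sup>2) * (- 2 * P $ i $ i - 2 / (1 + t\<^sup>2) * (v \<bullet> (P *v v))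
            + 4 / (1 + t\<^sup>2) * (v \<bullet> (P *v e i))) =
          - 2 * (1 + t\<^sup>2) * P $ i $ i - 2 * (v \<bullet> (P *v v)) + 4 * (v \<bullet> (P *v e i))"
        using pos by (simp add: distrib_left right_diff_distrib) (simp add: algebra_simps)
      finally show ?thesis
        by (simp add: vPu vPv algebra_simps)
    qed
    from linear_le_quadratic_imp_zero[OF this] show ?thesis by simp
  qed
  then have "transpose P = P"
    by (simp add: vec_eq_iff transpose_def) metis
  with nonneg show ?thesis by (simp add: psd_matrix_def)
qed

lemma polar_factor_exists:
  fixes M :: "real^'n^'n"
  obtains V where "orthogonal_matrix V" "psd_matrix (transpose V ** M)"
proof -
  have "continuous_on {W. orthogonal_matrix W} (\<lambda>W :: real^'n^'n. trace (transpose W ** M))"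
    unfolding trace_def transpose_def matrix_matrix_mult_def by (simp add: continuous_intros)
  then obtain V :: "real^'n^'n" where V: "orthogonal_matrix V"
    and max: "\<And>W. orthogonal_matrix W \<Longrightarrow> trace (transpose W ** M) \<le> trace (transpose V ** M)"
    using continuous_attains_sup[OF orthogonal_matrices_compact] orthogonal_matrix_id by blast
  have "trace (W ** (transpose V ** M)) \<le> trace (transpose V ** M)" if "orthogonal_matrix W" for W
    using max[of "V ** transpose W"] that V
    by (simp add: orthogonal_matrix_mul matrix_transpose_mul matrix_mul_assoc)
  then show thesis
    using that V trace_maximal_imp_psd by blast
qed

section \<open>Uniqueness of roots and of polar factors\<close>

text \<open>With \<open>L = R - S\<close> one has \<open>R L + L S = R\<^sup>2 - S\<^sup>2 = 0\<close>. Multiplying by \<open>L\<close> and taking traces,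
the nonnegative numbers \<open>trace (L R L)\<close> and \<open>trace (L S L)\<close> add up to \<open>0\<close>, so both vanish. Hence
\<open>R L = S L = 0\<close>, so that \<open>L\<^sup>2 = 0\<close>, and \<open>L = 0\<close> since \<open>L\<close> is symmetric.\<close>

lemma psd_root_unique:
  fixes R :: "real^'n^'n"
  assumes R: "psd_matrix R" and S: "psd_matrix S" and eq: "R ** R = S ** S"
  shows "R = S"
proof -
  define L where "L = R - S"
  have Lt: "transpose L = L"
    using R S by (simp add: L_def transpose_diff psd_matrix_def)
  have "R ** L + L ** S = 0"
    by (simp add: L_def matrix_simps eq)
  then have "L ** (R ** L + L ** S) = 0" by simp
  then have "trace (L ** (R ** L)) + trace (L ** (L ** S)) = 0"
    by (metis matrix_add_ldistrib trace_add trace_0 mat_0)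
  then have tr: "trace (transpose L ** R ** L) + trace (transpose L ** S ** L) = 0"
    using trace_mul_sym[of L "L ** S"] by (simp add: Lt matrix_mul_assoc)
  have kill: "R' ** L = 0" if psd: "psd_matrix R'" and tr: "trace (transpose L ** R' ** L) = 0" for R'
  proof -
    have diag: "0 \<le> (transpose L ** R' ** L) $ i $ i" for i
      by (rule psd_diag_nonneg[OF psd_congruence[OF psd]])
    have "(R' ** L) *v axis i 1 = 0" for i
    proof -
      have "(transpose L ** R' ** L) $ i $ i = 0"
        using tr sum_nonneg_eq_0_iff[of UNIV "\<lambda>i. (transpose L ** R' ** L) $ i $ i"] diag
        unfolding trace_def by simp
      then have "(L *v axis i 1) \<bullet> (R' *v (L *v axis i 1)) = 0"
        by (metis axis_form congruence_form)
      from psd_kernel[OF psd this] show ?thesis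
        by (simp only: matrix_vector_mul_assoc)
    qed
    then show ?thesis
      by (simp add: vec_eq_iff column_def matrix_vector_mult_basis)
  qed
  have "0 \<le> trace (transpose L ** R' ** L)" if "psd_matrix R'" for R'
    using psd_diag_nonneg[OF psd_congruence[OF that, of L]] by (simp add: trace_def sum_nonneg)
  with tr R S have "trace (transpose L ** R ** L) = 0" "trace (transpose L ** S ** L) = 0"
    by (smt (verit))+
  with kill R S have "R ** L - S ** L = 0" by simp
  then have LL: "L ** L = 0" using matrix_sub_rdistrib[of R S L] by (simp flip: L_def)
  have "L *v x = 0" for x
  proof -
    have "(L *v x) \<bullet> (L *v x) = x \<bullet> ((L ** L) *v x)"
      by (metis Lt inner_matrix_vector matrix_vector_mul_assoc)
    then show ?thesis by (simp add: LL)
  qed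
  then have "L = 0" by (simp add: matrix_eq)
  then show ?thesis by (simp add: L_def)
qed

lemma psd_sqrt_eqI: "psd_matrix R \<Longrightarrow> R ** R = M \<Longrightarrow> psd_sqrt M = R"
  unfolding psd_sqrt_def by (rule the_equality) (auto intro: psd_root_unique)

lemma matrix_inv_eqI:
  fixes M :: "real^'n^'n"
  assumes "M ** L = mat 1"
  shows "matrix_inv M = L"
proof -
  have L: "L ** M = mat 1" using assms matrix_left_right_inverse by blast
  then have "M ** matrix_inv M = mat 1 \<and> matrix_inv M ** M = mat 1"
    unfolding matrix_inv_def using assms by (metis (mono_tags, lifting) someI_ex)
  then show ?thesis
    by (metis L matrix_mul_assoc matrix_mul_lid matrix_mul_rid)
qed

lemma polar_decompositionI:
  assumes "orthogonal_matrix V" "psd_matrix R" "M = V ** R"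
  shows "polar_decomposition M V R"
proof -
  have "transpose M ** M = transpose R ** (transpose V ** V) ** R"
    by (simp add: assms matrix_transpose_mul matrix_mul_assoc)
  also have "\<dots> = R ** R"
    using assms by (simp add: orthogonal_matrix psd_matrix_def)
  finally show ?thesis
    using assms by (simp add: polar_decomposition_def psd_sqrt_eqI)
qed

lemma polar_decomposition_unique:
  fixes M :: "real^'n^'n"
  assumes "invertible M" and U: "polar_decomposition M U T" and V: "polar_decomposition M V R"
  shows "U = V \<and> T = R"
proof -
  have TR: "T = R" using U V unfolding polar_decomposition_def by metis
  have MT: "M = U ** T" and UU: "transpose U ** U = mat 1" "U ** transpose U = mat 1"
    using U unfolding polar_decomposition_def orthogonal_matrix_def by blast+
  have "T = transpose U ** M"
    by (simp add: MT UU matrix_mul_assoc)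
  moreover have "invertible (transpose U)"
    using UU by (auto simp: invertible_def)
  ultimately have "invertible T"
    using \<open>invertible M\<close> invertible_mult by blast
  then obtain L where "T ** L = mat 1" by (auto simp: invertible_def)
  moreover have "U ** T = V ** T"
    using U V TR unfolding polar_decomposition_def by metis
  ultimately have "U = V" by (metis matrix_mul_assoc matrix_mul_rid)
  with TR show ?thesis by simp
qed

lemma Pol_eqI:
  fixes M :: "real^'n^'n"
  assumes "invertible M" "polar_decomposition M V R"
  shows "Pol M = V"
  unfolding Pol_def using assms polar_decomposition_unique by (intro the_equality) blast+

lemma psd_shift_invertible:
  fixes Q :: "real^'n^'n"
  assumes "psd_matrix Q" "0 < c"
  shows "invertible (c *\<^sub>R mat 1 + Q)"
proof -
  have "x = 0" if "(c *\<^sub>R mat 1 + Q) *v x = 0" for x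
  proof -
    have "x \<bullet> ((c *\<^sub>R mat 1 + Q) *v x) = c * (x \<bullet> x) + x \<bullet> (Q *v x)"
      by (simp add: matrix_vector_mult_add_rdistrib inner_add_right flip: scaleR_matrix_vector_assoc)
    then have "c * (x \<bullet> x) + x \<bullet> (Q *v x) = 0" using that by simp
    moreover have "x \<bullet> (Q *v x) \<ge> 0" using assms by (simp add: psd_matrix_def)
    ultimately have "c * (x \<bullet> x) \<le> 0" by linarith
    then have "x \<bullet> x \<le> 0" using \<open>0 < c\<close> by (simp add: mult_le_0_iff)
    then show "x = 0" using inner_eq_zero_iff[of x] inner_ge_zero[of x] by linarith
  qed
  then show ?thesis
    by (simp add: invertible_left_inverse matrix_left_invertible_ker)
qed

section \<open>Block relations of Hadamard matrices\<close>

lemma block_matrix_mult: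
  "block_matrix A B C D ** block_matrix A' B' C' D' =
     block_matrix (A ** A' + B ** C') (A ** B' + B ** D') (C ** A' + D ** C') (C ** B' + D ** D')"
  by (simp add: vec_eq_iff block_matrix_def matrix_matrix_mult_def sum.Plus comp_def
      split: sum.split flip: UNIV_Plus_UNIV)

lemma transpose_block_matrix:
  "transpose (block_matrix A B C D) =
     block_matrix (transpose A) (transpose C) (transpose B) (transpose D)"
  by (simp add: vec_eq_iff block_matrix_def transpose_def split: sum.split)

lemma scaled_identity_block_matrix:
  "c *\<^sub>R mat 1 = block_matrix (c *\<^sub>R mat 1) 0 0 (c *\<^sub>R mat 1)"
  by (simp add: vec_eq_iff block_matrix_def mat_def split: sum.split)

lemma block_matrix_eq_iff:
  "block_matrix A B C D = block_matrix A' B' C' D' \<longleftrightarrow> A = A' \<and> B = B' \<and> C = C' \<and> D = D'"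
  (is "?l = ?r")
proof
  assume ?l
  then have "block_matrix A B C D $ i $ j = block_matrix A' B' C' D' $ i $ j" for i j by simp
  from this[of "Inl _" "Inl _"] this[of "Inl _" "Inr _"] this[of "Inr _" "Inl _"]
    this[of "Inr _" "Inr _"]
  show ?r by (simp add: block_matrix_def vec_eq_iff)
qed simp

lemma hadamard_mult_transpose:
  fixes H :: "real^'n^'n"
  assumes "hadamard H"
  shows "H ** transpose H = real CARD('n) *\<^sub>R mat 1"
    and "transpose H ** H = real CARD('n) *\<^sub>R mat 1"
proof -
  have "row i H \<bullet> row i H = real CARD('n)" for i
  proof -
    have "H $ i $ j * H $ i $ j = 1" for j
      using assms by (auto simp: hadamard_def pm1_matrices_def) (metis mult_1_left mult_minus1 minus_minus)
    then show ?thesis by (simp add: inner_vec_def row_def)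
  qed
  then show 1: "H ** transpose H = real CARD('n) *\<^sub>R mat 1"
    using assms
    by (auto simp: vec_eq_iff matrix_mult_transpose_dot_row mat_def hadamard_def orthogonal_def)
  then have "H ** ((1 / real CARD('n)) *\<^sub>R transpose H) = mat 1"
    by (simp add: matrix_scaleR_right)
  then have "((1 / real CARD('n)) *\<^sub>R transpose H) ** H = mat 1"
    by (simp add: matrix_left_right_inverse)
  then have "real CARD('n) *\<^sub>R ((1 / real CARD('n)) *\<^sub>R (transpose H ** H)) = real CARD('n) *\<^sub>R mat 1"
    by (simp add: matrix_scaleR_left)
  then show "transpose H ** H = real CARD('n) *\<^sub>R mat 1"
    by simp
qed

text \<open>The kernel of \<open>D\<close> injects under \<open>B\<close> into the kernel of \<open>A A\<^sup>t\<close>: if \<open>D x = 0\<close> then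
\<open>B\<^sup>t B x = c x\<close>, so \<open>B B\<^sup>t\<close> acts on \<open>B x\<close> as multiplication by \<open>c\<close> and leaves nothing for \<open>A A\<^sup>t\<close>.\<close>

lemma complementary_block_invertible:
  fixes A :: "real^'r^'r" and B :: "real^'d^'r" and D :: "real^'d^'d"
  assumes AA: "A ** transpose A + B ** transpose B = c *\<^sub>R mat 1"
    and BB: "transpose B ** B + transpose D ** D = c *\<^sub>R mat 1"
    and "c \<noteq> 0" and "invertible A"
  shows "invertible D"
proof -
  have "x = 0" if "D *v x = 0" for x
  proof -
    have "c *\<^sub>R x = (transpose B ** B + transpose D ** D) *v x"
      by (simp add: BB flip: scaleR_matrix_vector_assoc)
    also have "\<dots> = transpose B *v (B *v x)"
      using that by (simp add: matrix_vector_mult_add_rdistrib flip: matrix_vector_mul_assoc)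
    finally have x: "c *\<^sub>R x = transpose B *v (B *v x)" .
    have "(A ** transpose A + B ** transpose B) *v (B *v x) = c *\<^sub>R (B *v x)"
      by (simp add: AA flip: scaleR_matrix_vector_assoc)
    moreover have "(B ** transpose B) *v (B *v x) = c *\<^sub>R (B *v x)"
      by (simp add: x[symmetric] matrix_vector_mult_scaleR flip: matrix_vector_mul_assoc)
    ultimately have "(A ** transpose A) *v (B *v x) = 0"
      by (simp add: matrix_vector_mult_add_rdistrib)
    moreover have "invertible (A ** transpose A)"
      using \<open>invertible A\<close> by (simp add: invertible_mult transpose_invertible)
    ultimately have "B *v x = 0"
      by (simp add: invertible_left_inverse matrix_left_invertible_ker)
    with x \<open>c \<noteq> 0\<close> show "x = 0" by simp
  qed
  then show ?thesis
    by (simp add: invertible_left_inverse matrix_left_invertible_ker)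
qed

section \<open>The polar decomposition of the complementary block\<close>

text \<open>The block relations say that \<open>[A B; C D] / n\<close> is orthogonal, and \<open>V\<close> is an orthogonal polar
factor of \<open>A\<close>. The proof reduces every product of \<open>D\<close>, \<open>E\<close> and \<open>S\<close> to a linear
expression by means of \<open>Q Y = Y Q = I - n Y\<close>.\<close>

lemma complementary_block_polar:
  fixes A :: "real^'r^'r" and B :: "real^'d^'r" and C :: "real^'r^'d" and D :: "real^'d^'d"
  assumes "0 < n"
    and AA: "A ** transpose A + B ** transpose B = n\<^sup>2 *\<^sub>R mat 1"
    and CA: "C ** transpose A + D ** transpose B = 0"
    and ACC: "transpose A ** A + transpose C ** C = n\<^sup>2 *\<^sub>R mat 1"
    and BA: "transpose B ** A + transpose D ** C = 0"
    and BB: "transpose B ** B + transpose D ** D = n\<^sup>2 *\<^sub>R mat 1"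
    and V: "orthogonal_matrix V" and psdQ: "psd_matrix (A ** transpose V)"
    and Y: "Y ** (n *\<^sub>R mat 1 + A ** transpose V) = mat 1"
  shows "polar_decomposition D ((1 / n) *\<^sub>R (D - C ** transpose V ** Y ** B))
           (n *\<^sub>R mat 1 - transpose B ** Y ** B)"
proof -
  define Q where "Q = A ** transpose V"
  define S where "S = transpose B ** Y ** B"
  define E where "E = C ** transpose V ** Y ** B"
  have VV: "transpose V ** V = mat 1" "V ** transpose V = mat 1"
    using V by (auto simp: orthogonal_matrix_def)
  have Qt: "transpose Q = Q" using psdQ by (simp add: psd_matrix_def Q_def)
  have AQ: "A = Q ** V"
    by (simp add: Q_def VV flip: matrix_mul_assoc)
  have AtQ: "transpose A = transpose V ** Q"
    by (subst AQ) (simp add: matrix_transpose_mul Qt)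
  have QQ: "Q ** Q = A ** transpose A"
  proof -
    have "Q ** transpose Q = A ** (transpose V ** V) ** transpose A"
      by (simp add: Q_def matrix_transpose_mul matrix_mul_assoc)
    then show ?thesis by (simp add: Qt VV)
  qed
  have KY: "(n *\<^sub>R mat 1 + Q) ** Y = mat 1"
    using Y matrix_left_right_inverse by (auto simp: Q_def)
  have QY: "Q ** Y = mat 1 - n *\<^sub>R Y"
    using KY by (simp add: matrix_simps algebra_simps)
  have YQ: "Y ** Q = mat 1 - n *\<^sub>R Y"
    using Y by (simp add: matrix_simps algebra_simps flip: Q_def)
  have Yt: "transpose Y = Y"
  proof -
    have "transpose (Y ** (n *\<^sub>R mat 1 + Q)) = mat 1"
      using Y by (simp add: Q_def)
    then have "(n *\<^sub>R mat 1 + Q) ** transpose Y = mat 1"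
      by (simp add: matrix_transpose_mul transpose_add transpose_scalar Qt)
    then show ?thesis
      using Y by (metis Q_def matrix_mul_assoc matrix_mul_lid matrix_mul_rid)
  qed
  \<comment> \<open>\<open>B B\<^sup>t = n\<^sup>2 I - Q\<^sup>2\<close> has the factor \<open>n I + Q\<close>, which \<open>Y\<close> cancels.
    The sum \<open>n Y + n Y\<close> stands for the scalar multiple \<open>2 n Y\<close>; a numeral times a matrix would be
    an entrywise product.\<close>
  have YBBY: "Y ** (B ** transpose B) ** Y = n *\<^sub>R Y + n *\<^sub>R Y - mat 1"
  proof -
    have "B ** transpose B = n\<^sup>2 *\<^sub>R mat 1 - Q ** Q"
      using AA by (simp add: QQ algebra_simps)
    then have "Y ** (B ** transpose B) ** Y = n\<^sup>2 *\<^sub>R (Y ** Y) - (Y ** Q) ** (Q ** Y)"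
      by (simp add: matrix_simps matrix_mul_assoc)
    also have "\<dots> = n *\<^sub>R Y + n *\<^sub>R Y - mat 1"
      by (simp add: QY YQ matrix_simps power2_eq_square algebra_simps)
    finally show ?thesis .
  qed
  have ES: "E ** S = n *\<^sub>R E + n *\<^sub>R E - C ** transpose V ** B"
  proof -
    have "E ** S = C ** transpose V ** (Y ** (B ** transpose B) ** Y) ** B"
      by (simp add: E_def S_def matrix_mul_assoc)
    then show ?thesis by (simp only: YBBY matrix_simps matrix_mul_rid E_def)
  qed
  have DS: "D ** S = n *\<^sub>R E - C ** transpose V ** B"
  proof -
    have "D ** S = (D ** transpose B) ** Y ** B"
      by (simp add: S_def matrix_mul_assoc)
    also have "D ** transpose B = - (C ** transpose V ** Q)"
      using CA by (simp add: AtQ matrix_mul_assoc eq_neg_iff_add_eq_0 add.commute)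
    also have "- (C ** transpose V ** Q) ** Y ** B = - (C ** transpose V ** (Q ** Y) ** B)"
      by (simp add: matrix_minus_left matrix_mul_assoc)
    also have "\<dots> = n *\<^sub>R E - C ** transpose V ** B"
      by (simp add: QY matrix_simps E_def)
    finally show ?thesis .
  qed
  have DE: "transpose D ** E = n *\<^sub>R S - transpose B ** B"
  proof -
    have "transpose D ** E = (transpose D ** C) ** transpose V ** Y ** B"
      by (simp add: E_def matrix_mul_assoc)
    also have "transpose D ** C = - (transpose B ** A)"
      using BA by (simp add: eq_neg_iff_add_eq_0 add.commute)
    also have "- (transpose B ** A) ** transpose V ** Y ** B = - (transpose B ** (Q ** Y) ** B)"
      by (simp add: matrix_minus_left matrix_mul_assoc Q_def)
    also have "\<dots> = n *\<^sub>R S - transpose B ** B"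
      by (simp add: QY matrix_simps S_def)
    finally show ?thesis .
  qed
  \<comment> \<open>Conjugating \<open>C\<^sup>t C = n\<^sup>2 I - A\<^sup>t A\<close> by \<open>V\<close> gives \<open>n\<^sup>2 I - Q\<^sup>2 = B B\<^sup>t\<close>, so \<open>E\<^sup>t E = S\<^sup>2\<close>.\<close>
  have EE: "transpose E ** E = n *\<^sub>R S + n *\<^sub>R S - transpose B ** B"
  proof -
    have "transpose C ** C = n\<^sup>2 *\<^sub>R mat 1 - transpose A ** A"
      using ACC by (simp add: algebra_simps)
    then have "V ** (transpose C ** C) ** transpose V =
        n\<^sup>2 *\<^sub>R mat 1 - V ** (transpose V ** Q) ** (Q ** V) ** transpose V"
      by (simp add: matrix_simps VV AtQ matrix_mul_assoc flip: AQ)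
    also have "\<dots> = n\<^sup>2 *\<^sub>R mat 1 - (V ** transpose V) ** Q ** Q ** (V ** transpose V)"
      by (simp only: matrix_mul_assoc)
    also have "\<dots> = B ** transpose B"
      using AA by (simp add: VV QQ algebra_simps)
    finally have VCV: "V ** (transpose C ** C) ** transpose V = B ** transpose B" .
    have "transpose E ** E =
        transpose B ** (Y ** (V ** (transpose C ** C) ** transpose V) ** Y) ** B"
      by (simp add: E_def matrix_transpose_mul Yt matrix_mul_assoc)
    then show ?thesis by (simp only: VCV YBBY matrix_simps matrix_mul_rid S_def)
  qed
  have St: "transpose S = S"
    by (simp add: S_def matrix_transpose_mul Yt matrix_mul_assoc)
  have orth: "orthogonal_matrix ((1 / n) *\<^sub>R (D - E))"
  proof -
    have ED: "transpose E ** D = n *\<^sub>R S - transpose B ** B"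
      using arg_cong[OF DE, of transpose] by (simp add: matrix_simps St)
    have "transpose (D - E) ** (D - E) = transpose D ** D + transpose B ** B"
      by (simp add: matrix_simps DE ED EE algebra_simps)
    also have "\<dots> = n\<^sup>2 *\<^sub>R mat 1" using BB by (simp add: add.commute)
    finally show ?thesis
      using \<open>0 < n\<close>
      by (simp add: orthogonal_matrix transpose_scalar matrix_scaleR_left matrix_scaleR_right power2_eq_square)
  qed
  have psd: "psd_matrix (n *\<^sub>R mat 1 - S)"
  proof -
    have "0 \<le> x \<bullet> ((n *\<^sub>R mat 1 - S) *v x)" for x
    proof -
      \<comment> \<open>In terms of \<open>y = Y B x\<close> the form of \<open>Q Y\<close> at \<open>B x = n y + Q y\<close> is \<open>n y\<^sup>t Q y + |Q y|\<^sup>2\<close>.\<close>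
      define y where "y = Y *v (B *v x)"
      have Bx: "B *v x = n *\<^sub>R y + Q *v y"
      proof -
        have "B *v x = (n *\<^sub>R mat 1 + Q) *v y"
          using KY unfolding y_def by (metis matrix_vector_mul_assoc matrix_vector_mul_lid)
        then show ?thesis
          by (simp add: matrix_vector_mult_add_rdistrib flip: scaleR_matrix_vector_assoc)
      qed
      have xSx: "x \<bullet> (S *v x) = (B *v x) \<bullet> y"
        unfolding S_def by (simp add: congruence_form y_def)
      have "(B *v x) \<bullet> (B *v x) + (D *v x) \<bullet> (D *v x) =
          x \<bullet> ((transpose B ** B + transpose D ** D) *v x)"
        using inner_matrix_vector[of x "transpose B"] inner_matrix_vector[of x "transpose D"]
        by (simp add: matrix_vector_mult_add_rdistrib inner_add_right flip: matrix_vector_mul_assoc)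
      also have "\<dots> = n\<^sup>2 * (x \<bullet> x)"
        by (simp add: BB flip: scaleR_matrix_vector_assoc)
      finally have xx: "(B *v x) \<bullet> (B *v x) + (D *v x) \<bullet> (D *v x) = n\<^sup>2 * (x \<bullet> x)" .
      have "n * (x \<bullet> ((n *\<^sub>R mat 1 - S) *v x)) = n\<^sup>2 * (x \<bullet> x) - n * ((B *v x) \<bullet> y)"
        by (simp add: matrix_vector_mult_diff_rdistrib inner_diff_right xSx power2_eq_square
            right_diff_distrib flip: scaleR_matrix_vector_assoc)
      also have "\<dots> = (D *v x) \<bullet> (D *v x) + (B *v x) \<bullet> (Q *v y)"
        unfolding xx[symmetric]
        by (subst (2) Bx) (simp add: inner_add_right)
      also have "(B *v x) \<bullet> (Q *v y) = n * (y \<bullet> (Q *v y)) + (Q *v y) \<bullet> (Q *v y)"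
        by (simp add: Bx inner_add_left)
      finally have "0 \<le> n * (x \<bullet> ((n *\<^sub>R mat 1 - S) *v x))"
        using psdQ \<open>0 < n\<close> by (simp add: psd_matrix_def Q_def)
      then show ?thesis using \<open>0 < n\<close> by (simp add: zero_le_mult_iff)
    qed
    then show ?thesis by (simp add: psd_matrix_def transpose_diff transpose_scalar St)
  qed
  have "D = ((1 / n) *\<^sub>R (D - E)) ** (n *\<^sub>R mat 1 - S)"
  proof -
    have "(D - E) ** (n *\<^sub>R mat 1 - S) = n *\<^sub>R D"
      by (simp add: matrix_simps DS ES algebra_simps)
    then show ?thesis using \<open>0 < n\<close> by (simp add: matrix_scaleR_left)
  qed
  from polar_decompositionI[OF orth psd this] show ?thesis
    by (simp add: E_def S_def)
qed

theorem lemma3p2: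
  fixes A :: "real^'r^'r" and B :: "real^'d^'r" and C :: "real^'r^'d" and D :: "real^'d^'d"
    and H :: "real^('r + 'd)^('r + 'd)" and N :: nat and E S U T :: "real^'d^'d"
  assumes "N = CARD('r) + CARD('d)"
    and "H = block_matrix A B C D"
    and "hadamard H"
    and "A \<in> pm1_matrices" and "invertible A"
    and "D \<in> pm1_matrices"
    and "onorm ((*v) A) < sqrt (real N)"
    and "E = C ** X_mat N A ** B"
    and "S = transpose B ** Y_mat N A ** B"
  shows "polar_decomposition D U T \<longleftrightarrow>
           U = (1 / sqrt (real N)) *\<^sub>R (D - E) \<and> T = sqrt (real N) *\<^sub>R mat 1 - S"
proof -
  define n where "n = sqrt (real N)"
  have "0 < real N"
    using assms(1) zero_less_card_finite[where 'a='r] by linarith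
  then have n: "0 < n" "n\<^sup>2 = real N"
    by (simp_all add: n_def)
  have "H ** transpose H = n\<^sup>2 *\<^sub>R mat 1" "transpose H ** H = n\<^sup>2 *\<^sub>R mat 1"
    using hadamard_mult_transpose[OF \<open>hadamard H\<close>] assms(1) n by simp_all
  then have AA: "A ** transpose A + B ** transpose B = n\<^sup>2 *\<^sub>R mat 1"
    and CA: "C ** transpose A + D ** transpose B = 0"
    and ACC: "transpose A ** A + transpose C ** C = n\<^sup>2 *\<^sub>R mat 1"
    and BA: "transpose B ** A + transpose D ** C = 0"
    and BB: "transpose B ** B + transpose D ** D = n\<^sup>2 *\<^sub>R mat 1"
    unfolding assms(2) transpose_block_matrix block_matrix_mult scaled_identity_block_matrix
      block_matrix_eq_iff by blast+
  obtain V where V: "orthogonal_matrix V" and psd: "psd_matrix (transpose V ** A)"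
    using polar_factor_exists .
  define P Q where "P = transpose V ** A" and "Q = A ** transpose V"
  have VV: "transpose V ** V = mat 1" "V ** transpose V = mat 1"
    using V by (auto simp: orthogonal_matrix_def)
  have A: "polar_decomposition A V P"
    using V psd by (intro polar_decompositionI) (simp_all add: P_def VV matrix_mul_assoc)
  have "transpose (transpose V) ** P ** transpose V = Q"
    by (simp add: P_def Q_def VV matrix_mul_assoc)
  then have psdQ: "psd_matrix Q"
    using psd_congruence psd unfolding P_def by metis
  \<comment> \<open>The root of \<open>A A\<^sup>t\<close> is the positive polar factor of \<open>A\<^sup>t = V\<^sup>t Q\<close>.\<close>
  have "polar_decomposition (transpose A) (transpose V) Q"
  proof (rule polar_decompositionI[OF _ psdQ])
    have "transpose A = transpose V ** transpose Q"
      by (simp add: Q_def matrix_transpose_mul matrix_mul_assoc VV)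
    then show "transpose A = transpose V ** Q"
      using psdQ by (simp add: psd_matrix_def)
  qed (use V in simp)
  then have sqrtQ: "psd_sqrt (A ** transpose A) = Q"
    by (metis polar_decomposition_def transpose_transpose)
  have sqrtP: "psd_sqrt (transpose A ** A) = P"
    using A by (metis polar_decomposition_def)
  have PolA: "Pol A = V"
    using Pol_eqI[OF \<open>invertible A\<close> A] .
  obtain Y where Y: "(n *\<^sub>R mat 1 + Q) ** Y = mat 1" "Y ** (n *\<^sub>R mat 1 + Q) = mat 1"
    using psd_shift_invertible[OF psdQ n(1)] by (auto simp: invertible_def)
  have Y_eq: "Y_mat N A = Y"
    unfolding Y_mat_def sqrtQ n_def[symmetric] using Y(1) by (rule matrix_inv_eqI)
  \<comment> \<open>\<open>n I + P\<close> is conjugate to \<open>n I + Q\<close> under \<open>V\<close>, hence so are the inverses.\<close>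
  have X_eq: "X_mat N A = transpose V ** Y"
  proof -
    have "(n *\<^sub>R mat 1 + P) ** (transpose V ** Y ** V) = transpose V ** ((n *\<^sub>R mat 1 + Q) ** Y) ** V"
      by (simp add: P_def Q_def matrix_simps matrix_mul_assoc)
    also have "\<dots> = mat 1" by (simp add: Y VV)
    finally have "matrix_inv (n *\<^sub>R mat 1 + P) = transpose V ** Y ** V"
      by (rule matrix_inv_eqI)
    then show ?thesis
      unfolding X_mat_def sqrtP PolA n_def[symmetric] by (simp add: VV flip: matrix_mul_assoc)
  qed
  have polar: "polar_decomposition D ((1 / n) *\<^sub>R (D - E)) (n *\<^sub>R mat 1 - S)"
    using complementary_block_polar[OF n(1) AA CA ACC BA BB V psdQ[unfolded Q_def] Y(2)[unfolded Q_def]]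
    by (simp add: assms(8,9) X_eq Y_eq matrix_mul_assoc)
  have "invertible D"
    using complementary_block_invertible[OF AA BB _ \<open>invertible A\<close>] n(1) by simp
  from polar_decomposition_unique[OF this _ polar] polar show ?thesis
    unfolding n_def by blast
qed

end
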